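(* Let $R$ be a commutative Noetherian ring and $I$ a regular ideal of $R$. Then the set $\mathcal{C}(I)=\{J : J \text{ is a regular ideal of } R \text{ and } r(I,J)=\overline{I}\}$, ordered by inclusion, has a unique maximal element.
   Context: An ideal is regular if it contains a nonzerodivisor of $R$. $\overline{I}$ denotes the integral closure of $I$ in $R$. For a finitely generated $R$-module $M$ and submodules $A,B$ of $M$, $(A:B)=\{x\in R : xB\subseteq A\}$, and $r(I,M)=\bigcup_{k\geq 1}(I^{k+1}M:I^kM)$ (an ascending union of ideals of $R$). Here $r(I,J)$ is $r(I,M)$ for $M=J$ regarded as an $R$-module. *)

theory Defs
  imports "HOL-Algebra.Algebra"
begin

definition nonzerodivisor :: "('a, 'm) ring_scheme \<Rightarrow> 'a \<Rightarrow> bool" where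
  "nonzerodivisor R d \<longleftrightarrow>
     d \<in> carrier R \<and> (\<forall>x\<in>carrier R. d \<otimes>\<^bsub>R\<^esub> x = \<zero>\<^bsub>R\<^esub> \<longrightarrow> x = \<zero>\<^bsub>R\<^esub>)"

text \<open>A regular ideal may be the whole ring.\<close>

definition regular_ideal :: "'a set \<Rightarrow> ('a, 'm) ring_scheme \<Rightarrow> bool" where
  "regular_ideal I R \<longleftrightarrow> ideal I R \<and> (\<exists>d\<in>I. nonzerodivisor R d)"

abbreviation ideal_pow :: "('a, 'm) ring_scheme \<Rightarrow> 'a set \<Rightarrow> nat \<Rightarrow> 'a set" where
  "ideal_pow R I k \<equiv> I [^]\<^bsub>ideals_set R\<^esub> k"

text \<open>The elements \<open>x\<close> of \<open>R\<close> satisfying an equation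
  \<open>x ^ n + a 1 * x ^ (n - 1) + \<dots> + a n = 0\<close> with \<open>n \<ge> 1\<close> and
  \<open>a i\<close> in the \<open>i\<close>-th power of \<open>I\<close>.\<close>

definition integral_closure :: "('a, 'm) ring_scheme \<Rightarrow> 'a set \<Rightarrow> 'a set" where
  "integral_closure R I =
     {x \<in> carrier R. \<exists>n\<ge>1. \<exists>a::nat \<Rightarrow> 'a. (\<forall>i\<in>{1..n}. a i \<in> ideal_pow R I i) \<and>
        x [^]\<^bsub>R\<^esub> n \<oplus>\<^bsub>R\<^esub> (\<Oplus>\<^bsub>R\<^esub>i\<in>{1..n}. a i \<otimes>\<^bsub>R\<^esub> x [^]\<^bsub>R\<^esub> (n - i)) = \<zero>\<^bsub>R\<^esub>}"

text \<open>The submodule \<open>I N\<close> of \<open>M\<close>, for an ideal \<open>I\<close> of \<open>R\<close> and a submodule \<open>N\<close> of \<open>M\<close>: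
  the finite nonempty sums of products \<open>i \<odot> x\<close>, as in \<^const>\<open>ideal_prod\<close>.\<close>

inductive_set ideal_smult :: "('a, 'b, 'm) module_scheme \<Rightarrow> 'a set \<Rightarrow> 'b set \<Rightarrow> 'b set"
  for M and I and N where
    smult: "\<lbrakk> i \<in> I; x \<in> N \<rbrakk> \<Longrightarrow> i \<odot>\<^bsub>M\<^esub> x \<in> ideal_smult M I N"
  | add: "\<lbrakk> s \<in> ideal_smult M I N; t \<in> ideal_smult M I N \<rbrakk> \<Longrightarrow> s \<oplus>\<^bsub>M\<^esub> t \<in> ideal_smult M I N"

definition module_colon ::
    "('a, 'n) ring_scheme \<Rightarrow> ('a, 'b, 'm) module_scheme \<Rightarrow> 'b set \<Rightarrow> 'b set \<Rightarrow> 'a set" where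
  "module_colon R M A B = {x \<in> carrier R. \<forall>b\<in>B. x \<odot>\<^bsub>M\<^esub> b \<in> A}"

definition r_ideal ::
    "('a, 'n) ring_scheme \<Rightarrow> 'a set \<Rightarrow> ('a, 'b, 'm) module_scheme \<Rightarrow> 'a set" where
  "r_ideal R I M =
     (\<Union>k\<in>{1..}. module_colon R M (ideal_smult M (ideal_pow R I (k + 1)) (carrier M))
                                   (ideal_smult M (ideal_pow R I k) (carrier M)))"

text \<open>An ideal \<open>J\<close> of \<open>R\<close> regarded as an \<open>R\<close>-module. The fields \<^const>\<open>monoid.mult\<close> and
  \<^const>\<open>monoid.one\<close> of the record play no role in \<^const>\<open>module\<close>.\<close>

definition ideal_module :: "('a, 'm) ring_scheme \<Rightarrow> 'a set \<Rightarrow> ('a, 'a) module" where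
  "ideal_module R J =
     \<lparr> carrier = J, monoid.mult = monoid.mult R, monoid.one = monoid.one R, ring.zero = ring.zero R, ring.add = ring.add R, module.smult = monoid.mult R \<rparr>"

lemma ideal_module_is_module:
  assumes "cring R" "ideal J R"
  shows "module R (ideal_module R J)"
proof -
  interpret R: cring R by fact
  interpret J: ideal J R by fact
  show ?thesis
  proof (rule moduleI)
    show "abelian_group (ideal_module R J)"
    proof (rule abelian_groupI)
      fix x assume "x \<in> carrier (ideal_module R J)"
      then show "\<exists>y\<in>carrier (ideal_module R J).
          y \<oplus>\<^bsub>ideal_module R J\<^esub> x = \<zero>\<^bsub>ideal_module R J\<^esub>"
        by (auto simp: ideal_module_def intro!: bexI[of _ "\<ominus>\<^bsub>R\<^esub> x"] R.l_neg J.Icarr J.a_inv_closed)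
    qed (auto simp: ideal_module_def J.a_closed J.zero_closed R.a_ac J.Icarr)
  qed (auto simp: ideal_module_def R.cring_axioms J.I_l_closed R.l_distr R.r_distr R.m_assoc J.Icarr)
qed

lemma ideal_smult_ideal_module: "ideal_smult (ideal_module R J) I N = ideal_prod R I N"
proof (intro equalityI subsetI)
  fix x assume "x \<in> ideal_smult (ideal_module R J) I N"
  then show "x \<in> ideal_prod R I N"
    by induction (simp_all add: ideal_module_def ideal_prod.intros)
next
  fix x assume "x \<in> ideal_prod R I N"
  then show "x \<in> ideal_smult (ideal_module R J) I N"
  proof induction
    case (prod i j)
    then show ?case
      using ideal_smult.smult[of i I j N "ideal_module R J"] by (simp add: ideal_module_def)
  next
    case (sum s t)
    then show ?case
      using ideal_smult.add[of s "ideal_module R J" I N t] by (simp add: ideal_module_def)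
  qed
qed

definition C_set :: "('a, 'm) ring_scheme \<Rightarrow> 'a set \<Rightarrow> 'a set set" where
  "C_set R I = {J. regular_ideal J R \<and> r_ideal R I (ideal_module R J) = integral_closure R I}"

end

theory Submission
  imports Defs
begin

text \<open>
  The key point is that one inclusion between \<open>r(I, J)\<close> and the integral closure of \<open>I\<close> holds for
  every regular ideal \<open>J\<close>, so that membership of \<open>J\<close> in \<open>C(I)\<close> only asks that \<open>r(I, J)\<close> be large
  enough; and being large is inherited by sums.

  \<^item> Suppose \<open>x\<close> lies in \<open>r(I, J)\<close>. For some \<open>k\<close> the ideal \<open>N = I^k J\<close> satisfies \<open>x N \<subseteq> I N\<close>, and \<open>N\<close>
    is finitely generated and contains a nonzerodivisor. The determinant trick then gives an integral
    equation for \<open>x\<close> over \<open>I\<close> (\<open>integral_if_regular_ideal_absorbs\<close>, \<open>r_subset_integral_closure\<close>).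

  \<^item> Suppose \<open>x\<close> is integral over \<open>I\<close> and let \<open>L = I + x R\<close>. Integrality means exactly that
    \<open>x^(m+1) \<in> I L^m\<close> for some \<open>m\<close> (\<open>integral_closure_iff\<close>), and then \<open>x L^m \<subseteq> I L^m\<close>, whence
    \<open>x \<in> r(I, L^m)\<close>. So every single integral element lies in \<open>r(I, K)\<close> for some regular \<open>K\<close>.

  \<^item> Multiplying \<open>J\<close> by another ideal can only enlarge \<open>r(I, J)\<close>. Choose a regular \<open>J\<close> for which the
    ideal \<open>r(I, J)\<close> is maximal. For \<open>x\<close> integral and \<open>K\<close> as above, \<open>r(I, J K)\<close> contains both
    \<open>r(I, J)\<close> and \<open>x\<close>, so maximality puts \<open>x\<close> into \<open>r(I, J)\<close>. Thus \<open>J\<close> belongs to \<open>C(I)\<close>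
    (\<open>C_set_nonempty\<close>).

  \<^item> Since \<open>r(I, J) \<inter> r(I, K) \<subseteq> r(I, J + K)\<close>, the set \<open>C(I)\<close> is closed under sums (\<open>C_set_sum\<close>).
    By the Noetherian property it has a maximal element, and two maximal elements both equal their
    sum.
\<close>

section \<open>Arithmetic of ideals\<close>

lemma ideal_pow_0: "ideal_pow R I 0 = carrier R"
  by (simp add: ideals_set_def)

lemma ideal_pow_Suc: "ideal_pow R I (Suc k) = ideal_pow R I k \<cdot>\<^bsub>R\<^esub> I"
  by (simp add: ideals_set_def)

lemma ideal_prod_mono:
  "A \<subseteq> B \<Longrightarrow> C \<subseteq> D \<Longrightarrow> A \<cdot>\<^bsub>R\<^esub> C \<subseteq> B \<cdot>\<^bsub>R\<^esub> D"
proof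
  fix s assume "A \<subseteq> B" "C \<subseteq> D" "s \<in> A \<cdot>\<^bsub>R\<^esub> C"
  from this(3,1,2) show "s \<in> B \<cdot>\<^bsub>R\<^esub> D"
    by induction (auto intro: ideal_prod.intros)
qed

lemma ideal_pow_mono: "A \<subseteq> B \<Longrightarrow> ideal_pow R A k \<subseteq> ideal_pow R B k"
  by (induction k) (simp_all only: ideal_pow_0 ideal_pow_Suc ideal_prod_mono order_refl)

context cring
begin

lemma ideal_add_closed: "ideal A R \<Longrightarrow> a \<in> A \<Longrightarrow> b \<in> A \<Longrightarrow> a \<oplus> b \<in> A"
  by (simp add: additive_subgroup.a_closed ideal.axioms(1))

lemma ideal_minus_closed: "ideal A R \<Longrightarrow> a \<in> A \<Longrightarrow> b \<in> A \<Longrightarrow> a \<ominus> b \<in> A"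
  by (simp add: a_minus_def additive_subgroup.a_closed additive_subgroup.a_inv_closed ideal.axioms(1))

lemma ideal_zero_closed: "ideal A R \<Longrightarrow> \<zero> \<in> A"
  by (simp add: additive_subgroup.zero_closed ideal.axioms(1))

lemma ideal_pow_ideal: "ideal I R \<Longrightarrow> ideal (ideal_pow R I k) R"
  by (induction k) (simp_all only: ideal_pow_0 ideal_pow_Suc ideal_prod_is_ideal oneideal)

lemma ideal_pow_1: "ideal I R \<Longrightarrow> ideal_pow R I (Suc 0) = I"
  by (simp only: ideal_pow_0 ideal_pow_Suc)
    (metis ideal_prod_commute ideal_prod_one oneideal)

lemma ideal_pow_Suc_left: "ideal I R \<Longrightarrow> ideal_pow R I (Suc k) = I \<cdot> ideal_pow R I k"
  by (simp only: ideal_pow_Suc ideal_prod_commute ideal_pow_ideal)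

lemma ideal_pow_Suc_prod:
  assumes "ideal I R" "ideal J R"
  shows "ideal_pow R I (Suc k) \<cdot> J = I \<cdot> (ideal_pow R I k \<cdot> J)"
  using assms by (simp only: ideal_pow_Suc_left ideal_prod_assoc ideal_pow_ideal)

lemma nat_pow_mem_ideal_pow:
  assumes "ideal L R" "x \<in> L"
  shows "x [^] k \<in> ideal_pow R L k"
proof (induction k)
  case 0
  show ?case unfolding ideal_pow_0 by simp
next
  case (Suc k)
  then show ?case using assms unfolding ideal_pow_Suc
    by (simp add: ideal_prod.prod)
qed

lemma ideal_prod_subset:
  assumes "ideal K R" "\<And>a b. a \<in> A \<Longrightarrow> b \<in> B \<Longrightarrow> a \<otimes> b \<in> K"
  shows "A \<cdot> B \<subseteq> K"
proof
  fix s assume "s \<in> A \<cdot> B"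
  then show "s \<in> K"
    by induction (auto simp: assms ideal_add_closed)
qed

lemma colon_ideal:
  assumes "ideal A R" "B \<subseteq> carrier R"
  shows "ideal {x \<in> carrier R. \<forall>b\<in>B. x \<otimes> b \<in> A} R"
proof (rule idealI[OF ring_axioms])
  interpret A: ideal A R by fact
  have B: "b \<in> carrier R" if "b \<in> B" for b using that assms(2) by blast
  show "subgroup {x \<in> carrier R. \<forall>b\<in>B. x \<otimes> b \<in> A} (add_monoid R)"
  proof (rule add.subgroupI)
    have "\<zero> \<in> {x \<in> carrier R. \<forall>b\<in>B. x \<otimes> b \<in> A}"
      by (simp add: B A.zero_closed)
    then show "{x \<in> carrier R. \<forall>b\<in>B. x \<otimes> b \<in> A} \<noteq> {}" by blast
  qed (simp_all add: l_distr l_minus B A.a_closed A.a_inv_closed subset_iff)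
  fix a x assume a: "a \<in> {x \<in> carrier R. \<forall>b\<in>B. x \<otimes> b \<in> A}" and x: "x \<in> carrier R"
  show "x \<otimes> a \<in> {x \<in> carrier R. \<forall>b\<in>B. x \<otimes> b \<in> A}"
    using a x by (auto simp: m_assoc B A.I_l_closed)
  then show "a \<otimes> x \<in> {x \<in> carrier R. \<forall>b\<in>B. x \<otimes> b \<in> A}"
    using a x by (simp add: m_comm)
qed

text \<open>The colon condition \<open>x B \<subseteq> A\<close> survives multiplication of both sides by an ideal; this is why
  \<open>(I^(k+1) J : I^k J)\<close> grows with \<open>k\<close> and when \<open>J\<close> is replaced by a multiple.\<close>

lemma colon_prod:
  assumes "ideal B R" "ideal C R" "x \<in> carrier R"
    and "\<forall>b\<in>B. x \<otimes> b \<in> A"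
  shows "\<forall>b\<in>C \<cdot> B. x \<otimes> b \<in> C \<cdot> A"
proof
  fix b assume "b \<in> C \<cdot> B"
  then show "x \<otimes> b \<in> C \<cdot> A"
  proof induction
    case (prod c b)
    then have "x \<otimes> (c \<otimes> b) = c \<otimes> (x \<otimes> b)"
      using assms by (meson ideal.Icarr m_lcomm)
    with prod assms(4) show ?case by (simp add: ideal_prod.prod)
  next
    case (sum s t)
    then have "s \<in> carrier R" "t \<in> carrier R"
      using ideal_prod_in_carrier assms by blast+
    then show ?case
      using sum assms(3) by (simp add: r_distr ideal_prod.sum)
  qed
qed

lemma ideal_sum_left: "ideal A R \<Longrightarrow> ideal B R \<Longrightarrow> A \<subseteq> A <+> B"
  using genideal_self[of "A \<union> B"] ideal.Icarr[of A R] ideal.Icarr[of B R] union_genideal[of A B]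
  by blast

lemma ideal_sum_right: "ideal A R \<Longrightarrow> ideal B R \<Longrightarrow> B \<subseteq> A <+> B"
  using ideal_sum_left[of B A] union_genideal[of A B] union_genideal[of B A] by (simp add: Un_commute)

lemma ideal_sum_subset: "ideal K R \<Longrightarrow> A \<subseteq> K \<Longrightarrow> B \<subseteq> K \<Longrightarrow> A <+> B \<subseteq> K"
  unfolding set_add_def' using ideal_add_closed by blast

lemma nonzerodivisor_mult:
  assumes "nonzerodivisor R c" "nonzerodivisor R d"
  shows "nonzerodivisor R (c \<otimes> d)"
  using assms unfolding nonzerodivisor_def by (metis m_assoc m_closed)

lemma regular_ideal_prod:
  assumes "regular_ideal A R" "regular_ideal B R"
  shows "regular_ideal (A \<cdot> B) R"
proof -
  obtain c d where "c \<in> A" "nonzerodivisor R c" "d \<in> B" "nonzerodivisor R d"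
    using assms unfolding regular_ideal_def by blast
  then have "c \<otimes> d \<in> A \<cdot> B" "nonzerodivisor R (c \<otimes> d)"
    by (simp_all add: ideal_prod.prod nonzerodivisor_mult)
  moreover have "ideal (A \<cdot> B) R"
    using assms unfolding regular_ideal_def by (simp add: ideal_prod_is_ideal)
  ultimately show ?thesis unfolding regular_ideal_def by blast
qed

lemma regular_ideal_mono: "regular_ideal A R \<Longrightarrow> ideal B R \<Longrightarrow> A \<subseteq> B \<Longrightarrow> regular_ideal B R"
  unfolding regular_ideal_def by blast

lemma regular_ideal_carrier: "regular_ideal (carrier R) R"
proof -
  have "nonzerodivisor R \<one>" unfolding nonzerodivisor_def by simp
  then show ?thesis unfolding regular_ideal_def using oneideal one_closed by blast
qed

lemma regular_ideal_pow: "regular_ideal A R \<Longrightarrow> regular_ideal (ideal_pow R A k) R"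
proof (induction k)
  case 0
  show ?case unfolding ideal_pow_0 by (rule regular_ideal_carrier)
next
  case (Suc k)
  then show ?case unfolding ideal_pow_Suc by (simp add: regular_ideal_prod)
qed

lemma noetherian_exists_maximal:
  assumes "noetherian_ring R" "S \<noteq> {}" "\<And>A. A \<in> S \<Longrightarrow> ideal A R"
  shows "\<exists>M\<in>S. \<forall>A\<in>S. M \<subseteq> A \<longrightarrow> A = M"
proof (rule subset_Zorn_nonempty[OF assms(2)])
  fix C assume C: "C \<noteq> {}" "subset.chain S C"
  then have "subset.chain {A. ideal A R} C"
    using assms(3) unfolding pred_on.chain_def by auto
  then show "\<Union>C \<in> S"
    using noetherian_ring.ideal_chain_is_trivial[OF assms(1) C(1)] C(2)
    unfolding pred_on.chain_def by auto
qed

section \<open>Integrality over an ideal\<close>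

abbreviation adjoin :: "'a set \<Rightarrow> 'a \<Rightarrow> 'a set"
  where "adjoin I x \<equiv> I <+> PIdl x"

lemma adjoin_ideal: "ideal I R \<Longrightarrow> x \<in> carrier R \<Longrightarrow> ideal (adjoin I x) R"
  by (simp add: add_ideals cgenideal_ideal)

lemma subset_adjoin: "ideal I R \<Longrightarrow> x \<in> carrier R \<Longrightarrow> I \<subseteq> adjoin I x"
  by (simp add: ideal_sum_left cgenideal_ideal)

lemma mem_adjoin: "ideal I R \<Longrightarrow> x \<in> carrier R \<Longrightarrow> x \<in> adjoin I x"
  using ideal_sum_right[of I "PIdl x"] cgenideal_ideal cgenideal_self by blast

lemma adjoin_elim:
  assumes "l \<in> adjoin I x"
  obtains c r where "c \<in> I" "r \<in> carrier R" "l = c \<oplus> r \<otimes> x"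
  using assms unfolding set_add_def' cgenideal_def by blast

lemma adjoin_subset: "ideal K R \<Longrightarrow> I \<subseteq> K \<Longrightarrow> x \<in> K \<Longrightarrow> adjoin I x \<subseteq> K"
  by (simp add: ideal_sum_subset cgenideal_minimal)

text \<open>The values \<open>a 1 * x^(n-1) + \<dots> + a n\<close> with \<open>a i \<in> I^i\<close>, that is, the lower order parts of the integral
  equations of degree \<open>n\<close>. The recursion is Horner's scheme; it makes the closure
  properties below short inductions, without manipulation of indexed sums.\<close>

primrec horner :: "'a set \<Rightarrow> 'a \<Rightarrow> nat \<Rightarrow> 'a set" where
  "horner I x 0 = {\<zero>}"
| "horner I x (Suc n) = {x \<otimes> t \<oplus> c |t c. t \<in> horner I x n \<and> c \<in> ideal_pow R I (Suc n)}"

lemma horner_eq_sums: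
  assumes I: "ideal I R" and x: "x \<in> carrier R"
  shows "horner I x n =
    {(\<Oplus>i\<in>{1..n}. a i \<otimes> x [^] (n - i)) |a. \<forall>i\<in>{1..n}. a i \<in> ideal_pow R I i}"
proof (induction n)
  case 0
  show ?case by simp
next
  case (Suc n)
  have step: "(\<Oplus>i\<in>{1..Suc n}. a i \<otimes> x [^] (Suc n - i))
      = x \<otimes> (\<Oplus>i\<in>{1..n}. a i \<otimes> x [^] (n - i)) \<oplus> a (Suc n)"
    if a: "\<forall>i\<in>{1..Suc n}. a i \<in> ideal_pow R I i" for a
  proof -
    have c: "a i \<in> carrier R" if "i \<in> {1..Suc n}" for i
      using a that ideal.Icarr[OF ideal_pow_ideal[OF I]] by blast
    have "(\<Oplus>i\<in>{1..Suc n}. a i \<otimes> x [^] (Suc n - i))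
        = a (Suc n) \<oplus> (\<Oplus>i\<in>{1..n}. a i \<otimes> x [^] (Suc n - i))"
      using c x by (simp add: atLeastAtMostSuc_conv Pi_def)
    also have "(\<Oplus>i\<in>{1..n}. a i \<otimes> x [^] (Suc n - i))
        = (\<Oplus>i\<in>{1..n}. x \<otimes> (a i \<otimes> x [^] (n - i)))"
    proof (rule finsum_cong')
      fix i assume i: "i \<in> {1..n}"
      then have "x [^] (Suc n - i) = x [^] (n - i) \<otimes> x"
        by (simp add: Suc_diff_le)
      with i c x show "a i \<otimes> x [^] (Suc n - i) = x \<otimes> (a i \<otimes> x [^] (n - i))"
        by (simp add: m_ac)
    qed (use c x in auto)
    also have "\<dots> = x \<otimes> (\<Oplus>i\<in>{1..n}. a i \<otimes> x [^] (n - i))"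
      using c x by (subst finsum_rdistr) (auto simp: Pi_def)
    finally show ?thesis
      using c x by (simp add: a_comm Pi_def)
  qed
  show ?case
  proof (intro equalityI subsetI)
    fix s assume "s \<in> horner I x (Suc n)"
    then obtain a c where c: "c \<in> ideal_pow R I (Suc n)"
      and a: "\<forall>i\<in>{1..n}. a i \<in> ideal_pow R I i"
      and s: "s = x \<otimes> (\<Oplus>i\<in>{1..n}. a i \<otimes> x [^] (n - i)) \<oplus> c"
      using Suc.IH by auto
    define b where "b = a(Suc n := c)"
    have b: "\<forall>i\<in>{1..Suc n}. b i \<in> ideal_pow R I i"
    proof
      fix i assume "i \<in> {1..Suc n}"
      then show "b i \<in> ideal_pow R I i"
        using a c by (cases "i = Suc n") (auto simp: b_def simp del: nat_pow_Suc Group.nat_pow_Suc)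
    qed
    have "(\<Oplus>i\<in>{1..n}. b i \<otimes> x [^] (n - i)) = (\<Oplus>i\<in>{1..n}. a i \<otimes> x [^] (n - i))"
      using a x ideal.Icarr[OF ideal_pow_ideal[OF I]]
      by (intro finsum_cong') (auto simp: b_def)
    then have "s = (\<Oplus>i\<in>{1..Suc n}. b i \<otimes> x [^] (Suc n - i))"
      unfolding step[OF b] s by (simp add: b_def)
    with b show "s \<in> {(\<Oplus>i\<in>{1..Suc n}. a i \<otimes> x [^] (Suc n - i)) |a.
        \<forall>i\<in>{1..Suc n}. a i \<in> ideal_pow R I i}" by blast
  next
    fix s assume "s \<in> {(\<Oplus>i\<in>{1..Suc n}. a i \<otimes> x [^] (Suc n - i)) |a.
        \<forall>i\<in>{1..Suc n}. a i \<in> ideal_pow R I i}"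
    then obtain a where a: "\<forall>i\<in>{1..Suc n}. a i \<in> ideal_pow R I i"
      and s: "s = (\<Oplus>i\<in>{1..Suc n}. a i \<otimes> x [^] (Suc n - i))" by blast
    have "\<forall>i\<in>{1..n}. a i \<in> ideal_pow R I i" and "a (Suc n) \<in> ideal_pow R I (Suc n)"
      using a by (simp_all del: nat_pow_Suc Group.nat_pow_Suc)
    then show "s \<in> horner I x (Suc n)"
      unfolding s step[OF a] horner.simps Suc.IH by blast
  qed
qed

lemma horner_carrier:
  assumes "ideal I R" "x \<in> carrier R"
  shows "horner I x n \<subseteq> carrier R"
proof (induction n)
  case (Suc n)
  have "c \<in> carrier R" if "c \<in> ideal_pow R I (Suc n)" for c
    using that ideal.Icarr[OF ideal_pow_ideal[OF assms(1)]] by blast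
  with Suc assms(2) show ?case by (auto simp del: nat_pow_Suc Group.nat_pow_Suc)
qed simp

lemma horner_add:
  assumes "ideal I R" "x \<in> carrier R"
  shows "s \<in> horner I x n \<Longrightarrow> t \<in> horner I x n \<Longrightarrow> s \<oplus> t \<in> horner I x n"
proof (induction n arbitrary: s t)
  case (Suc n)
  then obtain s' t' c d where
    st: "s' \<in> horner I x n" "t' \<in> horner I x n" "s = x \<otimes> s' \<oplus> c" "t = x \<otimes> t' \<oplus> d"
    and cd: "c \<in> ideal_pow R I (Suc n)" "d \<in> ideal_pow R I (Suc n)"
    by (auto simp del: nat_pow_Suc Group.nat_pow_Suc)
  have carr: "s' \<in> carrier R" "t' \<in> carrier R" "c \<in> carrier R" "d \<in> carrier R"
    using st cd horner_carrier[OF assms] ideal.Icarr[OF ideal_pow_ideal[OF assms(1)]] by blast+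
  then have "s \<oplus> t = x \<otimes> (s' \<oplus> t') \<oplus> (c \<oplus> d)"
    using assms(2) by (simp add: st r_distr a_ac)
  then show ?case
    using Suc.IH[OF st(1,2)] ideal_add_closed[OF ideal_pow_ideal[OF assms(1)] cd]
    by (auto simp del: nat_pow_Suc Group.nat_pow_Suc)
qed simp

lemma horner_scale:
  assumes "ideal I R" "x \<in> carrier R" "r \<in> carrier R"
  shows "t \<in> horner I x n \<Longrightarrow> r \<otimes> t \<in> horner I x n"
proof (induction n arbitrary: t)
  case (Suc n)
  then obtain t' c where
    t: "t' \<in> horner I x n" "t = x \<otimes> t' \<oplus> c" and c: "c \<in> ideal_pow R I (Suc n)"
    by (auto simp del: nat_pow_Suc Group.nat_pow_Suc)
  have carr: "t' \<in> carrier R" "c \<in> carrier R"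
    using t c horner_carrier[OF assms(1,2)] ideal.Icarr[OF ideal_pow_ideal[OF assms(1)]] by blast+
  then have "r \<otimes> t = x \<otimes> (r \<otimes> t') \<oplus> r \<otimes> c"
    using assms by (simp add: t r_distr m_ac)
  then show ?case
    using Suc.IH[OF t(1)] ideal.I_l_closed[OF ideal_pow_ideal[OF assms(1)] c assms(3)]
    by (auto simp del: nat_pow_Suc Group.nat_pow_Suc)
qed (use assms in simp)

lemma horner_mult_var:
  assumes "ideal I R" "x \<in> carrier R" "t \<in> horner I x n"
  shows "x \<otimes> t \<in> horner I x (Suc n)"
proof -
  have "x \<otimes> t = x \<otimes> t \<oplus> \<zero>"
    using assms horner_carrier[OF assms(1,2), of n] by auto
  then show ?thesis
    using assms(3) ideal_zero_closed[OF ideal_pow_ideal[OF assms(1)]]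
    unfolding horner.simps by blast
qed

lemma horner_mult_ideal:
  assumes "ideal I R" "x \<in> carrier R" "c \<in> I"
  shows "t \<in> horner I x n \<Longrightarrow> c \<otimes> t \<in> horner I x (Suc n)"
proof (induction n arbitrary: t)
  case 0
  have "\<zero> \<in> horner I x (Suc 0)"
    using horner_mult_var[OF assms(1,2), of \<zero> 0] assms(2) by simp
  with 0 show ?case
    using ideal.Icarr[OF assms(1,3)] by (simp del: horner.simps(2))
next
  case (Suc n)
  then obtain t' d where
    t: "t' \<in> horner I x n" "t = x \<otimes> t' \<oplus> d" and d: "d \<in> ideal_pow R I (Suc n)"
    by (auto simp del: nat_pow_Suc Group.nat_pow_Suc)
  have carr: "t' \<in> carrier R" "d \<in> carrier R" "c \<in> carrier R"
    using t d horner_carrier[OF assms(1,2)] ideal.Icarr[OF ideal_pow_ideal[OF assms(1)]]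
      ideal.Icarr[OF assms(1,3)] by blast+
  then have "c \<otimes> t = x \<otimes> (c \<otimes> t') \<oplus> c \<otimes> d"
    using assms by (simp add: t r_distr m_ac)
  moreover have "c \<otimes> d \<in> ideal_pow R I (Suc (Suc n))"
    unfolding ideal_pow_Suc_left[OF assms(1), of "Suc n"]
    using assms(3) d by (rule ideal_prod.prod)
  ultimately show ?case
    using Suc.IH[OF t(1)] unfolding horner.simps(2)[of I x "Suc n"] by blast
qed

text \<open>Both sides satisfy the same recursion. From left to right, \<open>x\<close> and \<open>I\<close> both lie in \<open>L = I + x R\<close>;
  from right to left, multiplying a Horner value by an element of \<open>I\<close> or by \<open>x\<close> gives a Horner
  value of the next degree.\<close>

lemma horner_eq_prod:
  assumes "ideal I R" "x \<in> carrier R"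
  shows "horner I x (Suc n) = I \<cdot> ideal_pow R (adjoin I x) n"
proof
  note L = adjoin_ideal[OF assms]
  note Ln = ideal_pow_ideal[OF L]
  have base: "horner I x (Suc 0) = I" "I \<cdot> ideal_pow R (adjoin I x) 0 = I"
    unfolding horner.simps ideal_pow_1[OF assms(1)] ideal_pow_0 ideal_prod_one[OF assms(1)]
    using assms(2) ideal.Icarr[OF assms(1)] by force+
  show "horner I x (Suc n) \<subseteq> I \<cdot> ideal_pow R (adjoin I x) n"
  proof (induction n)
    case 0
    show ?case unfolding base ..
  next
    case (Suc n)
    show ?case
    proof
      fix s assume "s \<in> horner I x (Suc (Suc n))"
      then obtain t c where s: "s = x \<otimes> t \<oplus> c" and t: "t \<in> horner I x (Suc n)"
        and c: "c \<in> ideal_pow R I (Suc (Suc n))"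
        unfolding horner.simps(2)[of I x "Suc n"] by blast
      have "x \<otimes> t \<in> adjoin I x \<cdot> (I \<cdot> ideal_pow R (adjoin I x) n)"
        using Suc t mem_adjoin[OF assms] by (blast intro: ideal_prod.prod)
      then have "x \<otimes> t \<in> I \<cdot> ideal_pow R (adjoin I x) (Suc n)"
        by (metis Ln L assms(1) ideal_pow_Suc_left ideal_prod_assoc ideal_prod_commute)
      moreover have "c \<in> I \<cdot> ideal_pow R (adjoin I x) (Suc n)"
        using c ideal_prod_mono[OF order_refl ideal_pow_mono[OF subset_adjoin[OF assms]]]
        unfolding ideal_pow_Suc_left[OF assms(1), of "Suc n"] by blast
      ultimately show "s \<in> I \<cdot> ideal_pow R (adjoin I x) (Suc n)"
        unfolding s by (rule ideal_prod.sum)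
    qed
  qed
  show "I \<cdot> ideal_pow R (adjoin I x) n \<subseteq> horner I x (Suc n)"
  proof (induction n)
    case 0
    show ?case unfolding base ..
  next
    case (Suc n)
    show ?case
    proof
      fix s assume "s \<in> I \<cdot> ideal_pow R (adjoin I x) (Suc n)"
      then have "s \<in> (I \<cdot> ideal_pow R (adjoin I x) n) \<cdot> adjoin I x"
        by (simp only: ideal_pow_Suc ideal_prod_assoc assms L Ln)
      then show "s \<in> horner I x (Suc (Suc n))"
      proof induction
        case (prod b l)
        obtain c r where l: "c \<in> I" "r \<in> carrier R" "l = c \<oplus> r \<otimes> x"
          using prod(2) by (rule adjoin_elim)
        have b: "b \<in> horner I x (Suc n)" using prod(1) Suc by blast
        then have carr: "b \<in> carrier R" "c \<in> carrier R"
          using horner_carrier[OF assms] ideal.Icarr[OF assms(1)] l(1) by blast+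
        have "b \<otimes> l = c \<otimes> b \<oplus> x \<otimes> (r \<otimes> b)"
          using carr l assms(2) by (simp add: r_distr m_ac)
        then show ?case
          using b l(1,2) assms
          by (simp only: horner_add horner_mult_ideal horner_mult_var horner_scale)
      next
        case (sum s t)
        then show ?case using assms by (blast intro: horner_add)
      qed
    qed
  qed
qed

text \<open>An integral equation of degree \<open>m + 1\<close> says that \<open>x^(m+1)\<close> is the negative of a Horner value,
  and the Horner values of a fixed positive degree form an ideal. All later arguments use
  integrality in this form, free of coefficients.\<close>

lemma integral_closure_iff:
  assumes "ideal I R" "x \<in> carrier R"
  shows "x \<in> integral_closure R I \<longleftrightarrow> (\<exists>m. x [^] Suc m \<in> I \<cdot> ideal_pow R (adjoin I x) m)"
proof -
  have neg: "(\<exists>s\<in>K. y \<oplus> s = \<zero>) \<longleftrightarrow> y \<in> K" if K: "ideal K R" and y: "y \<in> carrier R" for K y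
  proof
    assume "\<exists>s\<in>K. y \<oplus> s = \<zero>"
    then obtain s where s: "s \<in> K" "y \<oplus> s = \<zero>" by blast
    then have "y = \<ominus> s"
      using y ideal.Icarr[OF K] by (simp add: minus_equality)
    then show "y \<in> K"
      using K s(1) by (simp add: additive_subgroup.a_inv_closed ideal.axioms(1))
  next
    assume "y \<in> K"
    then show "\<exists>s\<in>K. y \<oplus> s = \<zero>"
      using K y by (meson additive_subgroup.a_inv_closed ideal.axioms(1) r_neg)
  qed
  have "x \<in> integral_closure R I \<longleftrightarrow> (\<exists>n\<ge>1. \<exists>s\<in>horner I x n. x [^] n \<oplus> s = \<zero>)"
    unfolding integral_closure_def horner_eq_sums[OF assms] using assms(2) by auto
  also have "\<dots> \<longleftrightarrow> (\<exists>m. \<exists>s\<in>horner I x (Suc m). x [^] Suc m \<oplus> s = \<zero>)"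
    by (metis One_nat_def Suc_le_D Suc_le_mono le0)
  also have "\<dots> \<longleftrightarrow> (\<exists>m. x [^] Suc m \<in> I \<cdot> ideal_pow R (adjoin I x) m)"
    unfolding horner_eq_prod[OF assms]
    using neg ideal_prod_is_ideal[OF assms(1) ideal_pow_ideal[OF adjoin_ideal[OF assms]]]
      nat_pow_closed[OF assms(2)] by metis
  finally show ?thesis .
qed

text \<open>Expanding \<open>(I + x R)^(k+1)\<close>, every term apart from \<open>x^(k+1)\<close> has a factor in \<open>I\<close>.\<close>

lemma adjoin_pow_subset:
  assumes "ideal I R" "x \<in> carrier R"
  shows "ideal_pow R (adjoin I x) (Suc k)
    \<subseteq> adjoin (I \<cdot> ideal_pow R (adjoin I x) k) (x [^] Suc k)"
proof (induction k)
  case 0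
  have "x [^] Suc 0 = x" using assms(2) by simp
  then show ?case
    by (simp only: assms ideal_pow_1 adjoin_ideal ideal_pow_0 ideal_prod_one order_refl)
next
  case (Suc k)
  let ?L = "adjoin I x"
  let ?K = "adjoin (I \<cdot> ideal_pow R ?L (Suc k)) (x [^] Suc (Suc k))"
  note L = adjoin_ideal[OF assms]
  note Ln = ideal_pow_ideal[OF L]
  note P = ideal_prod_is_ideal[OF assms(1) Ln]
  have K: "ideal ?K R" by (intro adjoin_ideal P nat_pow_closed assms)
  have IK: "I \<cdot> ideal_pow R ?L (Suc k) \<subseteq> ?K" and xK: "x [^] Suc (Suc k) \<in> ?K"
    using subset_adjoin[OF P] mem_adjoin[OF P] nat_pow_closed[OF assms(2)] by blast+
  show ?case unfolding ideal_pow_Suc[of R ?L "Suc k"]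
  proof (rule ideal_prod_subset[OF K])
    fix a b assume a: "a \<in> ideal_pow R ?L (Suc k)" and b: "b \<in> ?L"
    obtain c r where l: "c \<in> I" "r \<in> carrier R" "b = c \<oplus> r \<otimes> x"
      using b by (rule adjoin_elim)
    obtain p q where p: "p \<in> I \<cdot> ideal_pow R ?L k" and q: "q \<in> carrier R"
      and apq: "a = p \<oplus> q \<otimes> x [^] Suc k"
      using a Suc by (blast elim: adjoin_elim)
    have carr: "a \<in> carrier R" "c \<in> carrier R" "p \<in> carrier R"
      using a l(1) p ideal.Icarr[OF Ln] ideal.Icarr[OF assms(1)] ideal.Icarr[OF P] by blast+
    have "a \<otimes> b = c \<otimes> a \<oplus> r \<otimes> (a \<otimes> x)"
      using carr l assms(2) by (simp add: r_distr m_ac)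
    also have "a \<otimes> x = p \<otimes> x \<oplus> q \<otimes> x [^] Suc (Suc k)"
      using carr q assms(2) by (simp add: apq l_distr m_assoc)
    finally have ab: "a \<otimes> b = c \<otimes> a \<oplus> r \<otimes> (p \<otimes> x \<oplus> q \<otimes> x [^] Suc (Suc k))" .
    have "p \<otimes> x \<in> I \<cdot> ideal_pow R ?L (Suc k)"
      unfolding ideal_pow_Suc ideal_prod_assoc[OF assms(1) Ln L, symmetric]
      using p mem_adjoin[OF assms] by (rule ideal_prod.prod)
    moreover have "c \<otimes> a \<in> I \<cdot> ideal_pow R ?L (Suc k)"
      using l(1) a by (rule ideal_prod.prod)
    ultimately show "a \<otimes> b \<in> ?K"
      unfolding ab using IK xK q l(2)
      by (meson K ideal.I_l_closed ideal_add_closed subsetD)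
  qed
qed

text \<open>The integral equation absorbs the one term \<open>x^(m+1)\<close> of \<open>L^(m+1)\<close> that has no factor in \<open>I\<close>,
  so \<open>L^(m+1) = I L^m\<close>: adjoining an integral element yields an ideal of which \<open>I\<close> is a reduction.\<close>

lemma integral_stabilizes:
  assumes "ideal I R" "x \<in> carrier R" and m: "x [^] Suc m \<in> I \<cdot> ideal_pow R (adjoin I x) m"
    and b: "b \<in> ideal_pow R (adjoin I x) m"
  shows "x \<otimes> b \<in> I \<cdot> ideal_pow R (adjoin I x) m"
proof -
  have K: "ideal (I \<cdot> ideal_pow R (adjoin I x) m) R"
    using assms by (intro ideal_prod_is_ideal ideal_pow_ideal adjoin_ideal)
  have "x \<otimes> b \<in> ideal_pow R (adjoin I x) (Suc m)"
    unfolding ideal_pow_Suc_left[OF adjoin_ideal[OF assms(1,2)]]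
    using mem_adjoin[OF assms(1,2)] b by (rule ideal_prod.prod)
  then show ?thesis
    using adjoin_pow_subset[OF assms(1,2), of m] adjoin_subset[OF K order_refl m] by blast
qed


section \<open>The determinant trick\<close>

lemma ideal_prod_adjoin_elim:
  assumes "ideal G R" "ideal N R" "n \<in> carrier R" "z \<in> G \<cdot> adjoin N n"
  obtains s g where "s \<in> G \<cdot> N" "g \<in> G" "z = s \<oplus> g \<otimes> n"
proof -
  note GN = ideal_prod_is_ideal[OF assms(1,2)]
  have "\<exists>s\<in>G \<cdot> N. \<exists>g\<in>G. z = s \<oplus> g \<otimes> n"
    using assms(4)
  proof induction
    case (prod i l)
    obtain c r where l: "c \<in> N" "r \<in> carrier R" "l = c \<oplus> r \<otimes> n"
      using prod(2) by (rule adjoin_elim)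
    have "i \<in> carrier R" "c \<in> carrier R"
      using prod(1) l(1) assms(1,2) by (simp_all add: ideal.Icarr)
    then have "i \<otimes> l = i \<otimes> c \<oplus> (i \<otimes> r) \<otimes> n"
      using l(2,3) assms(3) by (simp add: r_distr m_assoc)
    moreover have "i \<otimes> c \<in> G \<cdot> N" "i \<otimes> r \<in> G"
      using prod(1) l assms(1) by (simp_all add: ideal_prod.prod ideal.I_r_closed)
    ultimately show ?case by blast
  next
    case (sum z1 z2)
    then obtain s1 g1 s2 g2 where z: "s1 \<in> G \<cdot> N" "g1 \<in> G" "z1 = s1 \<oplus> g1 \<otimes> n"
        "s2 \<in> G \<cdot> N" "g2 \<in> G" "z2 = s2 \<oplus> g2 \<otimes> n" by blast
    then have "s1 \<in> carrier R" "s2 \<in> carrier R" "g1 \<in> carrier R" "g2 \<in> carrier R"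
      using GN assms(1) by (simp_all add: ideal.Icarr)
    then have "z1 \<oplus> z2 = (s1 \<oplus> s2) \<oplus> (g1 \<oplus> g2) \<otimes> n"
      using z assms(3) by (simp add: l_distr a_ac)
    moreover have "s1 \<oplus> s2 \<in> G \<cdot> N" "g1 \<oplus> g2 \<in> G"
      using z GN assms(1) by (simp_all add: ideal_add_closed)
    ultimately show ?case by blast
  qed
  with that show ?thesis by blast
qed

lemma annihilates_genideal:
  assumes "A \<subseteq> carrier R" "h \<in> carrier R" "\<forall>a\<in>A. h \<otimes> a = \<zero>" "b \<in> Idl A"
  shows "h \<otimes> b = \<zero>"
proof -
  let ?K = "{x \<in> carrier R. \<forall>b\<in>{h}. x \<otimes> b \<in> {\<zero>}}"
  have "A \<subseteq> ?K"
  proof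
    fix a assume "a \<in> A"
    with assms(1-3) have "a \<in> carrier R" "a \<otimes> h = \<zero>" by (auto simp: m_comm[of _ h])
    then show "a \<in> ?K" by simp
  qed
  then have "Idl A \<subseteq> ?K"
    using assms(2) by (intro genideal_minimal colon_ideal zeroideal) auto
  with assms(4) have "b \<in> carrier R" "b \<otimes> h = \<zero>" by auto
  with assms(2) show ?thesis by (simp add: m_comm)
qed

text \<open>If \<open>y N \<subseteq> G N\<close> with \<open>N\<close> finitely generated, then some \<open>y^(m+1) - g\<close> annihilates \<open>N\<close>, where
  \<open>g \<in> G (G + y R)^m\<close> plays the part of the lower order terms of a characteristic polynomial.
  Instead of a determinant, the proof eliminates one generator \<open>n\<close> at a time. The relation for \<open>n\<close>
  reads \<open>f n \<in> G N'\<close> with \<open>f = y - g0\<close>, where \<open>N'\<close> is generated by the other generators \<open>A\<close>.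
  Multiplying the relations of \<open>A\<close> by \<open>f\<close> removes \<open>n\<close> from them and leaves \<open>y^2 N' \<subseteq> G' N'\<close> with
  \<open>G' = (G + y R) G\<close>. Hence the induction is over \<open>A\<close> with \<open>G\<close> and \<open>y\<close> arbitrary. If \<open>h\<close> annihilates
  \<open>N'\<close>, then \<open>h f\<close> annihilates \<open>N'\<close> and \<open>n\<close>.\<close>

lemma determinant_trick:
  assumes "finite A" "A \<subseteq> carrier R" "ideal G R" "y \<in> carrier R"
    and "\<forall>a\<in>A. y \<otimes> a \<in> G \<cdot> (Idl A)"
  shows "\<exists>m. \<exists>g\<in>G \<cdot> ideal_pow R (adjoin G y) m. \<forall>a\<in>A. (y [^] Suc m \<ominus> g) \<otimes> a = \<zero>"
  using assms
proof (induction A arbitrary: G y rule: finite_induct)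
  case empty
  then have "ideal (G \<cdot> ideal_pow R (adjoin G y) 0) R"
    by (intro ideal_prod_is_ideal ideal_pow_ideal adjoin_ideal)
  then show ?case using ideal_zero_closed by blast
next
  case (insert n A)
  note G = \<open>ideal G R\<close> and y = \<open>y \<in> carrier R\<close>
  let ?N = "Idl A"
  let ?L = "adjoin G y"
  have A: "A \<subseteq> carrier R" and n: "n \<in> carrier R" using insert.prems(1) by auto
  have N: "ideal ?N R" using A by (rule genideal_ideal)
  note L = adjoin_ideal[OF G y] and GL = subset_adjoin[OF G y] and yL = mem_adjoin[OF G y]
  note GN = ideal_prod_is_ideal[OF G N]
  have "Idl (insert n A) \<subseteq> adjoin ?N n"
    using subset_adjoin[OF N n] mem_adjoin[OF N n] genideal_self[OF A]
    by (intro genideal_minimal adjoin_ideal N n) blast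
  then have G_gen: "G \<cdot> (Idl (insert n A)) \<subseteq> G \<cdot> adjoin ?N n"
    by (intro ideal_prod_mono order_refl)
  have elim: "\<exists>s\<in>G \<cdot> ?N. \<exists>g\<in>G. y \<otimes> a = s \<oplus> g \<otimes> n" if "a \<in> insert n A" for a
    using insert.prems(4) G_gen that ideal_prod_adjoin_elim[OF G N n] by (metis subsetD)
  obtain s0 g0 where s0: "s0 \<in> G \<cdot> ?N" and g0: "g0 \<in> G" and yn: "y \<otimes> n = s0 \<oplus> g0 \<otimes> n"
    using elim by blast
  have carr0: "s0 \<in> carrier R" "g0 \<in> carrier R"
    using ideal.Icarr[OF GN s0] ideal.Icarr[OF G g0] .
  \<comment> \<open>The pivot: up to an element of \<open>G\<close> it is \<open>y\<close>, and it moves \<open>n\<close> into \<open>G \<cdot> ?N\<close>.\<close>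
  define f where "f = y \<ominus> g0"
  have f: "f \<in> carrier R" using y carr0 by (simp add: f_def)
  have fL: "f \<in> ?L" using yL g0 GL L by (auto simp: f_def intro: ideal_minus_closed)
  have fn: "f \<otimes> n = s0"
  proof -
    have "f \<otimes> n = y \<otimes> n \<ominus> g0 \<otimes> n"
      using y n carr0 by (simp add: f_def a_minus_def l_distr l_minus)
    also have "\<dots> = s0"
      using n carr0 by (simp add: yn a_minus_def a_assoc r_neg)
    finally show ?thesis .
  qed
  let ?G = "?L \<cdot> G"
  let ?y = "y \<otimes> y"
  have G': "ideal ?G R" using L G by (rule ideal_prod_is_ideal)
  have G'N: "ideal (?G \<cdot> ?N) R" using G' N by (rule ideal_prod_is_ideal)
  have reduced: "?y \<otimes> a \<in> ?G \<cdot> ?N" if a: "a \<in> A" for a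
  proof -
    obtain s g where s: "s \<in> G \<cdot> ?N" and g: "g \<in> G" and ya: "y \<otimes> a = s \<oplus> g \<otimes> n"
      using elim a by blast
    have carr: "s \<in> carrier R" "g \<in> carrier R" "a \<in> carrier R"
      using ideal.Icarr[OF GN s] ideal.Icarr[OF G g] a A by auto
    have assoc: "?G \<cdot> ?N = ?L \<cdot> (G \<cdot> ?N)" using L G N by (rule ideal_prod_assoc)
    \<comment> \<open>Writing one factor \<open>y\<close> as \<open>f \<oplus> g0\<close> turns the \<open>n\<close>-term of \<open>y \<otimes> a\<close> into \<open>g \<otimes> s0\<close>.\<close>
    have "?y \<otimes> a = (f \<oplus> g0) \<otimes> (y \<otimes> a)"
      using y carr carr0 by (simp add: f_def a_minus_def a_assoc l_neg m_assoc)
    also have "\<dots> = f \<otimes> (s \<oplus> g \<otimes> n) \<oplus> g0 \<otimes> (y \<otimes> a)"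
      using f y carr carr0 by (simp add: l_distr flip: ya)
    also have "f \<otimes> (s \<oplus> g \<otimes> n) = f \<otimes> s \<oplus> g \<otimes> s0"
      using f carr n by (simp add: r_distr m_lcomm flip: fn)
    also have "g0 \<otimes> (y \<otimes> a) = (y \<otimes> g0) \<otimes> a"
      using y carr carr0 by (simp add: m_ac)
    finally have "?y \<otimes> a = f \<otimes> s \<oplus> g \<otimes> s0 \<oplus> (y \<otimes> g0) \<otimes> a" .
    moreover have "f \<otimes> s \<in> ?G \<cdot> ?N" "g \<otimes> s0 \<in> ?G \<cdot> ?N"
      unfolding assoc using fL s g GL s0 by (auto intro: ideal_prod.prod)
    moreover have "(y \<otimes> g0) \<otimes> a \<in> ?G \<cdot> ?N"
      using yL g0 a genideal_self[OF A] by (blast intro: ideal_prod.prod)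
    ultimately show ?thesis using G'N by (simp add: ideal_add_closed)
  qed
  obtain m g where g: "g \<in> ?G \<cdot> ideal_pow R (adjoin ?G ?y) m"
    and kill: "\<forall>a\<in>A. (?y [^] Suc m \<ominus> g) \<otimes> a = \<zero>"
    using insert.IH[OF A G', of ?y] y reduced by auto
  define h where "h = ?y [^] Suc m \<ominus> g"
  \<comment> \<open>The ideals of the reduced problem are expressed by powers of the original \<open>?L\<close>; degrees double.\<close>
  have "adjoin ?G ?y \<subseteq> ?L \<cdot> ?L"
    using L GL yL by (intro adjoin_subset ideal_prod_is_ideal ideal_prod_mono ideal_prod.prod) auto
  then have "ideal_pow R (adjoin ?G ?y) m \<subseteq> ideal_pow R (?L \<cdot> ?L) m"
    by (rule ideal_pow_mono)
  also have "ideal_pow R (?L \<cdot> ?L) m = ideal_pow R ?L (2 * m)"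
  proof (induction m)
    case (Suc m)
    have "ideal_pow R (?L \<cdot> ?L) (Suc m) = ideal_pow R ?L (2 * m) \<cdot> (?L \<cdot> ?L)"
      unfolding ideal_pow_Suc Suc ..
    also have "\<dots> = ideal_pow R ?L (Suc (Suc (2 * m)))"
      using L by (simp only: ideal_pow_Suc ideal_prod_assoc ideal_pow_ideal)
    finally show ?case by (simp del: nat_pow_Suc Group.nat_pow_Suc)
  qed (simp only: ideal_pow_0 mult_0_right)
  finally have "g \<in> ?G \<cdot> ideal_pow R ?L (2 * m)"
    using g ideal_prod_mono by blast
  then have gL: "g \<in> G \<cdot> ideal_pow R ?L (Suc (2 * m))"
    using L G by (simp only: ideal_pow_Suc_left ideal_prod_assoc[symmetric] ideal_pow_ideal
        ideal_prod_commute[OF L G])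
  have GLk: "ideal (G \<cdot> ideal_pow R ?L k) R" for k
    using G L by (intro ideal_prod_is_ideal ideal_pow_ideal)
  have gc: "g \<in> carrier R" using ideal.Icarr[OF GLk gL] .
  have h: "h \<in> carrier R" using y gc by (simp add: h_def)
  have ysq: "?y [^] Suc m = y [^] Suc (Suc (2 * m))"
  proof -
    have "?y [^] Suc m = (y [^] (2::nat)) [^] Suc m"
      using y by (simp add: numeral_2_eq_2)
    also have "\<dots> = y [^] (2 * Suc m)" using y by (rule nat_pow_pow)
    finally show ?thesis by simp
  qed
  \<comment> \<open>The lower order part of the product \<open>h \<otimes> f\<close>, whose leading term is \<open>y\<close> to the power \<open>2 * m + 3\<close>.\<close>
  define e where "e = g \<otimes> f \<oplus> g0 \<otimes> y [^] Suc (Suc (2 * m))"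
  have e: "e \<in> G \<cdot> ideal_pow R ?L (Suc (Suc (2 * m)))"
  proof -
    have "g \<otimes> f \<in> (G \<cdot> ideal_pow R ?L (Suc (2 * m))) \<cdot> ?L"
      using gL fL by (rule ideal_prod.prod)
    then have "g \<otimes> f \<in> G \<cdot> ideal_pow R ?L (Suc (Suc (2 * m)))"
      unfolding ideal_pow_Suc[of R ?L "Suc (2 * m)"]
      by (simp only: ideal_prod_assoc[OF G ideal_pow_ideal[OF L] L])
    moreover have "g0 \<otimes> y [^] Suc (Suc (2 * m)) \<in> G \<cdot> ideal_pow R ?L (Suc (Suc (2 * m)))"
      using g0 nat_pow_mem_ideal_pow[OF L yL] by (rule ideal_prod.prod)
    ultimately show ?thesis unfolding e_def by (rule ideal_prod.sum)
  qed
  have hf: "y [^] Suc (Suc (Suc (2 * m))) \<ominus> e = h \<otimes> f"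
  proof -
    define p where "p = y [^] Suc (Suc (2 * m))"
    have p: "p \<in> carrier R" using y unfolding p_def by (rule nat_pow_closed)
    have "h = p \<ominus> g" unfolding h_def ysq p_def ..
    then have "h \<otimes> f = p \<otimes> f \<ominus> g \<otimes> f"
      using p gc f by (simp add: a_minus_def l_distr l_minus)
    also have "p \<otimes> f = p \<otimes> y \<ominus> g0 \<otimes> p"
      using p y carr0 by (simp add: f_def a_minus_def r_distr r_minus m_comm)
    also have "p \<otimes> y \<ominus> g0 \<otimes> p \<ominus> g \<otimes> f = p \<otimes> y \<ominus> (g \<otimes> f \<oplus> g0 \<otimes> p)"
      using p y carr0 gc f by (simp add: a_minus_def minus_add a_ac)
    also have "p \<otimes> y = y [^] Suc (Suc (Suc (2 * m)))" by (simp add: p_def)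
    finally show ?thesis unfolding e_def p_def by simp
  qed
  have killN: "h \<otimes> b = \<zero>" if "b \<in> ?N" for b
    using annihilates_genideal[OF A h _ that] kill by (simp add: h_def)
  have "h \<otimes> f \<otimes> a = \<zero>" if "a \<in> insert n A" for a
  proof (cases "a = n")
    case True
    have "s0 \<in> ?N" using s0 ideal_prod_inter[OF G N] by blast
    then show ?thesis using killN h f n True by (simp add: m_assoc fn)
  next
    case False
    then have a: "a \<in> A" using that by simp
    then have "h \<otimes> f \<otimes> a = f \<otimes> (h \<otimes> a)" using A h f by (auto simp: m_ac)
    also have "\<dots> = \<zero>" using killN a genideal_self[OF A] f by auto
    finally show ?thesis .
  qed
  then have "\<forall>a\<in>insert n A. (y [^] Suc (Suc (Suc (2 * m))) \<ominus> e) \<otimes> a = \<zero>"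
    unfolding hf by blast
  with e show ?case by blast
qed

text \<open>An element that annihilates a regular ideal is zero, so the annihilating element of the determinant
  trick is itself an integral equation.\<close>

lemma integral_if_regular_ideal_absorbs:
  assumes "noetherian_ring R" "ideal I R" "regular_ideal N R" "x \<in> carrier R"
    and "\<forall>b\<in>N. x \<otimes> b \<in> I \<cdot> N"
  shows "x \<in> integral_closure R I"
proof -
  obtain d where d: "d \<in> N" "nonzerodivisor R d" and N: "ideal N R"
    using assms(3) unfolding regular_ideal_def by blast
  obtain A where A: "A \<subseteq> carrier R" "finite A" "N = Idl A"
    using noetherian_ring.finetely_gen[OF assms(1) N] by blast
  have "\<forall>a\<in>A. x \<otimes> a \<in> I \<cdot> (Idl A)"
    using assms(5) genideal_self[OF A(1)] A(3) by auto
  then obtain m g where g: "g \<in> I \<cdot> ideal_pow R (adjoin I x) m"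
    and kill: "\<forall>a\<in>A. (x [^] Suc m \<ominus> g) \<otimes> a = \<zero>"
    using determinant_trick[OF A(2,1) assms(2,4)] by blast
  have gc: "g \<in> carrier R"
    using g assms(2,4) by (meson adjoin_ideal ideal.Icarr ideal_pow_ideal ideal_prod_is_ideal)
  let ?h = "x [^] Suc m \<ominus> g"
  have xm: "x [^] Suc m \<in> carrier R" using assms(4) by (rule nat_pow_closed)
  have h: "?h \<in> carrier R" using xm gc by (rule minus_closed)
  have "?h \<otimes> d = \<zero>"
    using annihilates_genideal[OF A(1) h kill] d(1) A(3) by blast
  then have "?h = \<zero>"
    using d h unfolding nonzerodivisor_def by (metis m_comm)
  then have "x [^] Suc m = g" using xm gc by (simp only: r_right_minus_eq)
  with g show ?thesis
    using integral_closure_iff[OF assms(2,4)] by metis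
qed

section \<open>The ideals \<open>r(I, J)\<close>\<close>

abbreviation r_step :: "'a set \<Rightarrow> 'a set \<Rightarrow> nat \<Rightarrow> 'a set" where
  "r_step I J k \<equiv> {x \<in> carrier R. \<forall>b\<in>ideal_pow R I k \<cdot> J. x \<otimes> b \<in> ideal_pow R I (Suc k) \<cdot> J}"

abbreviation r :: "'a set \<Rightarrow> 'a set \<Rightarrow> 'a set" where
  "r I J \<equiv> r_ideal R I (ideal_module R J)"

lemma r_eq_Union: "r I J = (\<Union>k\<in>{1..}. r_step I J k)"
  unfolding r_ideal_def ideal_smult_ideal_module module_colon_def
  by (simp add: ideal_module_def del: nat_pow_Suc Group.nat_pow_Suc)

lemma r_step_ideal: "ideal I R \<Longrightarrow> ideal J R \<Longrightarrow> ideal (r_step I J k) R"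
  by (intro colon_ideal ideal_prod_is_ideal ideal_prod_in_carrier ideal_pow_ideal)

lemma r_step_mono:
  assumes "ideal I R" "ideal J R" "j \<le> k"
  shows "r_step I J j \<subseteq> r_step I J k"
proof -
  have "r_step I J k \<subseteq> r_step I J (Suc k)" for k
  proof
    fix x assume x: "x \<in> r_step I J k"
    then have "\<forall>b\<in>I \<cdot> (ideal_pow R I k \<cdot> J). x \<otimes> b \<in> I \<cdot> (ideal_pow R I (Suc k) \<cdot> J)"
      using assms by (intro colon_prod ideal_prod_is_ideal ideal_pow_ideal) blast+
    then show "x \<in> r_step I J (Suc k)"
      using x assms by (simp only: ideal_pow_Suc_prod mem_Collect_eq)
  qed
  then show ?thesis using lift_Suc_mono_le[of "r_step I J" j k] assms(3) by blast
qed

text \<open>An ascending union of ideals.\<close>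

lemma r_ideal_ideal:
  assumes "ideal I R" "ideal J R"
  shows "ideal (r I J) R"
proof -
  have "subset.chain {A. ideal A R} (r_step I J ` {1..})"
    unfolding subset_chain_def
  proof (intro conjI ballI)
    show "r_step I J ` {1..} \<subseteq> {A. ideal A R}"
      using r_step_ideal[OF assms] by blast
    fix A B assume "A \<in> r_step I J ` {1..}" "B \<in> r_step I J ` {1..}"
    then obtain j k where "A = r_step I J j" "B = r_step I J k" by blast
    then show "A \<subseteq> B \<or> B \<subseteq> A"
      using r_step_mono[OF assms] nat_le_linear[of j k] by blast
  qed
  from chain_Union_is_ideal[OF this] show ?thesis
    unfolding r_eq_Union by (auto split: if_splits)
qed

lemma r_step_prod:
  assumes "ideal I R" "ideal J R" "ideal K R"
  shows "r_step I J k \<subseteq> r_step I (J \<cdot> K) k"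
proof
  fix x assume x: "x \<in> r_step I J k"
  have eq: "ideal_pow R I i \<cdot> (J \<cdot> K) = K \<cdot> (ideal_pow R I i \<cdot> J)" for i
    using assms by (metis ideal_pow_ideal ideal_prod_assoc ideal_prod_commute ideal_prod_is_ideal)
  have "\<forall>b\<in>K \<cdot> (ideal_pow R I k \<cdot> J). x \<otimes> b \<in> K \<cdot> (ideal_pow R I (Suc k) \<cdot> J)"
    using x assms by (intro colon_prod ideal_prod_is_ideal ideal_pow_ideal) blast+
  then show "x \<in> r_step I (J \<cdot> K) k"
    unfolding eq using x by blast
qed

lemma r_prod:
  assumes "ideal I R" "ideal J R" "ideal K R"
  shows "r I J \<subseteq> r I (J \<cdot> K)"
  unfolding r_eq_Union using r_step_prod[OF assms] by (intro UN_mono order_refl)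

text \<open>The union defining \<open>r(I, J)\<close> starts at \<open>k = 1\<close>; the condition at \<open>k = 0\<close> implies the one at \<open>k = 1\<close>.\<close>

lemma mem_r_if_absorbs:
  assumes "ideal I R" "ideal J R" "x \<in> carrier R" "\<forall>b\<in>J. x \<otimes> b \<in> I \<cdot> J"
  shows "x \<in> r I J"
proof -
  have "\<forall>b\<in>I \<cdot> J. x \<otimes> b \<in> I \<cdot> (I \<cdot> J)"
    by (intro colon_prod assms ideal_prod_is_ideal)
  then have "x \<in> r_step I J 1"
    using assms by (simp only: One_nat_def ideal_pow_Suc_prod ideal_pow_1 mem_Collect_eq)
  then show ?thesis unfolding r_eq_Union by blast
qed

lemma r_subset_integral_closure:
  assumes "noetherian_ring R" "regular_ideal I R" "regular_ideal J R"
  shows "r I J \<subseteq> integral_closure R I"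
proof
  have IJ: "ideal I R" "ideal J R" using assms unfolding regular_ideal_def by blast+
  fix x assume "x \<in> r I J"
  then obtain k where "x \<in> r_step I J k" unfolding r_eq_Union by blast
  then have "x \<in> carrier R" "\<forall>b\<in>ideal_pow R I k \<cdot> J. x \<otimes> b \<in> I \<cdot> (ideal_pow R I k \<cdot> J)"
    unfolding ideal_pow_Suc_prod[OF IJ] by blast+
  then show "x \<in> integral_closure R I"
    using assms IJ
    by (intro integral_if_regular_ideal_absorbs[where N = "ideal_pow R I k \<cdot> J"]
        regular_ideal_prod regular_ideal_pow)
qed

text \<open>The witness is \<open>L^m\<close> with \<open>L = I + x R\<close>; it is regular because \<open>L\<close> contains \<open>I\<close>.\<close>

lemma integral_mem_r:
  assumes "regular_ideal I R" "x \<in> integral_closure R I"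
  shows "\<exists>K. regular_ideal K R \<and> x \<in> r I K"
proof -
  have I: "ideal I R" and x: "x \<in> carrier R"
    using assms unfolding regular_ideal_def integral_closure_def by blast+
  obtain m where m: "x [^] Suc m \<in> I \<cdot> ideal_pow R (adjoin I x) m"
    using assms(2) integral_closure_iff[OF I x] by blast
  have K: "regular_ideal (ideal_pow R (adjoin I x) m) R"
    using regular_ideal_mono[OF assms(1) adjoin_ideal subset_adjoin] I x
    by (intro regular_ideal_pow)
  moreover have "x \<in> r I (ideal_pow R (adjoin I x) m)"
    using I x integral_stabilizes[OF I x m]
    by (intro mem_r_if_absorbs ideal_pow_ideal adjoin_ideal) auto
  ultimately show ?thesis by blast
qed

text \<open>A maximal \<open>r(I, J)\<close> among regular \<open>J\<close> must contain each integral \<open>x\<close>, since multiplying \<open>J\<close> by an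
  ideal that handles \<open>x\<close> cannot enlarge \<open>r(I, J)\<close>. This handles all integral elements at once
  without choosing generators of the integral closure.\<close>

lemma C_set_nonempty:
  assumes "noetherian_ring R" "regular_ideal I R"
  shows "\<exists>J. J \<in> C_set R I"
proof -
  have I: "ideal I R" using assms(2) unfolding regular_ideal_def by blast
  have reg: "ideal J R" if "regular_ideal J R" for J using that unfolding regular_ideal_def by blast
  let ?S = "r I ` {J. regular_ideal J R}"
  have "?S \<noteq> {}" using assms(2) by blast
  moreover have "ideal A R" if "A \<in> ?S" for A using that r_ideal_ideal[OF I] reg by blast
  ultimately obtain A where "A \<in> ?S" and A: "\<And>B. B \<in> ?S \<Longrightarrow> A \<subseteq> B \<Longrightarrow> B = A"
    using noetherian_exists_maximal[OF assms(1), of ?S] by metis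
  then obtain J where J: "regular_ideal J R" "A = r I J" by blast
  have "x \<in> r I J" if x: "x \<in> integral_closure R I" for x
  proof -
    obtain K where K: "regular_ideal K R" "x \<in> r I K"
      using integral_mem_r[OF assms(2) x] by blast
    note ids = reg[OF J(1)] reg[OF K(1)]
    have "r I (J \<cdot> K) = A"
      using A[of "r I (J \<cdot> K)"] regular_ideal_prod[OF J(1) K(1)] r_prod[OF I ids] J(2) by blast
    moreover have "r I K \<subseteq> r I (J \<cdot> K)"
      using r_prod[OF I ids(2,1)] ideal_prod_commute[OF ids] by simp
    ultimately show ?thesis using K(2) J(2) by blast
  qed
  with r_subset_integral_closure[OF assms J(1)] have "r I J = integral_closure R I" by blast
  with J(1) show ?thesis unfolding C_set_def by blast
qed

text \<open>By monotonicity in \<open>k\<close> a common exponent serves both ideals, and products distribute over the sum.\<close>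

lemma r_sum:
  assumes "ideal I R" "ideal J R" "ideal K R"
  shows "r I J \<inter> r I K \<subseteq> r I (J <+> K)"
proof
  fix x assume "x \<in> r I J \<inter> r I K"
  then obtain j k where jk: "x \<in> r_step I J j" "x \<in> r_step I K k" "1 \<le> j"
    unfolding r_eq_Union by auto
  define n where "n = max j k"
  have le: "j \<le> n" "k \<le> n" by (simp_all add: n_def)
  have n: "x \<in> r_step I J n" "x \<in> r_step I K n" "1 \<le> n"
    using jk r_step_mono[OF assms(1,2) le(1)] r_step_mono[OF assms(1,3) le(2)] le by auto
  have distr: "ideal_pow R I i \<cdot> (J <+> K) = ideal_pow R I i \<cdot> J <+> ideal_pow R I i \<cdot> K" for i
    using assms by (intro ideal_prod_distr ideal_pow_ideal)
  have "x \<otimes> b \<in> ideal_pow R I (Suc n) \<cdot> (J <+> K)" 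
    if b: "b \<in> ideal_pow R I n \<cdot> (J <+> K)" for b
  proof -
    obtain u v where uv: "u \<in> ideal_pow R I n \<cdot> J" "v \<in> ideal_pow R I n \<cdot> K" "b = u \<oplus> v"
      using b[unfolded distr] unfolding set_add_def' by blast
    then have "u \<in> carrier R" "v \<in> carrier R"
      using assms ideal_prod_in_carrier ideal_pow_ideal by blast+
    then have "x \<otimes> b = x \<otimes> u \<oplus> x \<otimes> v"
      using n uv by (simp add: r_distr)
    moreover have "x \<otimes> u \<oplus> x \<otimes> v \<in> ideal_pow R I (Suc n) \<cdot> J <+> ideal_pow R I (Suc n) \<cdot> K"
      using n uv unfolding set_add_def' by blast
    ultimately show ?thesis unfolding distr by simp
  qed
  then have "x \<in> r_step I (J <+> K) n" using n by blast
  then show "x \<in> r I (J <+> K)" unfolding r_eq_Union using n(3) by blast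
qed

lemma C_set_sum:
  assumes "noetherian_ring R" "regular_ideal I R" "J \<in> C_set R I" "K \<in> C_set R I"
  shows "J <+> K \<in> C_set R I"
proof -
  have ids: "ideal I R" "ideal J R" "ideal K R" "regular_ideal J R"
    and r: "r I J = integral_closure R I" "r I K = integral_closure R I"
    using assms unfolding C_set_def regular_ideal_def by blast+
  have reg: "regular_ideal (J <+> K) R"
    using regular_ideal_mono[OF ids(4)] ideal_sum_left add_ideals ids by blast
  have "integral_closure R I \<subseteq> r I (J <+> K)"
    using r_sum[OF ids(1-3)] r by blast
  with r_subset_integral_closure[OF assms(1,2) reg] reg show ?thesis
    unfolding C_set_def by blast
qed

end

theorem theorem4p6:
  fixes R :: "('a, 'm) ring_scheme" and I :: "'a set"
  assumes "cring R" and "noetherian_ring R" and "regular_ideal I R"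
  shows "\<exists>!J. J \<in> C_set R I \<and> (\<forall>K\<in>C_set R I. J \<subseteq> K \<longrightarrow> K = J)"
proof -
  interpret cring R by fact
  have ideals: "ideal J R" if "J \<in> C_set R I" for J
    using that unfolding C_set_def regular_ideal_def by blast
  show ?thesis
  proof (rule ex_ex1I)
    show "\<exists>J. J \<in> C_set R I \<and> (\<forall>K\<in>C_set R I. J \<subseteq> K \<longrightarrow> K = J)"
      using noetherian_exists_maximal[OF assms(2), of "C_set R I"] ideals
        C_set_nonempty[OF assms(2,3)] by blast
  next
    fix J K
    assume J: "J \<in> C_set R I \<and> (\<forall>K\<in>C_set R I. J \<subseteq> K \<longrightarrow> K = J)"
      and K: "K \<in> C_set R I \<and> (\<forall>J\<in>C_set R I. K \<subseteq> J \<longrightarrow> J = K)"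
    have sum: "J <+>\<^bsub>R\<^esub> K \<in> C_set R I"
      using C_set_sum[OF assms(2,3)] J K by blast
    have "J \<subseteq> J <+>\<^bsub>R\<^esub> K" "K \<subseteq> J <+>\<^bsub>R\<^esub> K"
      using ideals J K by (simp_all add: ideal_sum_left ideal_sum_right)
    with sum J K show "J = K" by blast
  qed
qed

end
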